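(* Let $L=(L,\cdot)$ be a left quasigroup, $M=(M,\mu)$ a ternary system satisfying, for all $a,b,c,d\in M$, $$\mu(a,\mu(a,b,c),\mu(\mu(a,b,c),c,d))=\mu(a,b,\mu(b,c,d)),$$ $$\mu(\mu(a,b,c),c,d)=\mu(\mu(a,b,\mu(b,c,d)),\mu(b,c,d),d),$$ and $\pi:L\to M$ a bijection. Then the dynamical Yang-Baxter map $R^{(L,M,\pi)}(\lambda)$ satisfies the unitary condition if and only if $$\mu(a,\mu(a,b,c),c)=b\quad(\forall a,b,c\in M).$$
   Context: A left quasigroup $(L,\cdot)$ is a nonempty set $L$ with a binary operation such that for all $u,w\in L$ there is a unique $v\in L$ with $u\cdot v=w$; this $v$ is denoted $u\backslash_L w$, and $uv$ means $u\cdot v$. A ternary system $(M,\mu)$ is a nonempty set $M$ with a map $\mu:M^3\to M$. Given $(L,M,\pi)$, for $\lambda,u,v\in L$: $$\xi^{(L,M,\pi)}_\lambda(u)(v)=\lambda\backslash_L\pi^{-1}\bigl(\mu(\pi(\lambda),\pi(\lambda u),\pi((\lambda u)v))\bigr),$$ $$\eta^{(L,M,\pi)}_\lambda(u)(v)=\bigl(\lambda\,\xi^{(L,M,\pi)}_\lambda(v)(u)\bigr)\backslash_L\bigl((\lambda v)u\bigr),$$ $$R^{(L,M,\pi)}(\lambda)(u,v)=\bigl(\eta^{(L,M,\pi)}_\lambda(v)(u),\xi^{(L,M,\pi)}_\lambda(u)(v)\bigr).$$ A family $R(\lambda):L\times L\to L\times L$ ($\lambda\in L$) satisfies the unitary condition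 iff $R(\lambda)P_LR(\lambda)=P_L$ for all $\lambda\in L$, where $P_L(u,v)=(v,u)$. *)

theory Defs
  imports Main
begin

text \<open>
  Left quasigroups and ternary systems are given by an explicit nonempty carrier set together
  with an operation that is only constrained on that carrier.
\<close>

definition left_quasigroup :: "'a set \<Rightarrow> ('a \<Rightarrow> 'a \<Rightarrow> 'a) \<Rightarrow> bool" where
  "left_quasigroup L mul \<longleftrightarrow>
     L \<noteq> {} \<and> (\<forall>u\<in>L. \<forall>v\<in>L. mul u v \<in> L) \<and> (\<forall>u\<in>L. \<forall>w\<in>L. \<exists>!v. v \<in> L \<and> mul u v = w)"

definition ldiv :: "'a set \<Rightarrow> ('a \<Rightarrow> 'a \<Rightarrow> 'a) \<Rightarrow> 'a \<Rightarrow> 'a \<Rightarrow> 'a" where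
  "ldiv L mul u w = (THE v. v \<in> L \<and> mul u v = w)"

definition ternary_system :: "'b set \<Rightarrow> ('b \<Rightarrow> 'b \<Rightarrow> 'b \<Rightarrow> 'b) \<Rightarrow> bool" where
  "ternary_system M \<mu> \<longleftrightarrow> M \<noteq> {} \<and> (\<forall>a\<in>M. \<forall>b\<in>M. \<forall>c\<in>M. \<mu> a b c \<in> M)"

text \<open>
  The carrier of the ternary system does not occur in the formulas below: the inverse of the
  bijection from \<open>L\<close> onto it is \<open>inv_into L \<pi>\<close>.
\<close>

definition xi_map ::
  "'a set \<Rightarrow> ('a \<Rightarrow> 'a \<Rightarrow> 'a) \<Rightarrow> ('b \<Rightarrow> 'b \<Rightarrow> 'b \<Rightarrow> 'b) \<Rightarrow> ('a \<Rightarrow> 'b) \<Rightarrow> 'a \<Rightarrow> 'a \<Rightarrow> 'a \<Rightarrow> 'a" where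
  "xi_map L mul \<mu> \<pi> l u v =
     ldiv L mul l (inv_into L \<pi> (\<mu> (\<pi> l) (\<pi> (mul l u)) (\<pi> (mul (mul l u) v))))"

definition eta_map ::
  "'a set \<Rightarrow> ('a \<Rightarrow> 'a \<Rightarrow> 'a) \<Rightarrow> ('b \<Rightarrow> 'b \<Rightarrow> 'b \<Rightarrow> 'b) \<Rightarrow> ('a \<Rightarrow> 'b) \<Rightarrow> 'a \<Rightarrow> 'a \<Rightarrow> 'a \<Rightarrow> 'a" where
  "eta_map L mul \<mu> \<pi> l u v =
     ldiv L mul (mul l (xi_map L mul \<mu> \<pi> l v u)) (mul (mul l v) u)"

definition R_map ::
  "'a set \<Rightarrow> ('a \<Rightarrow> 'a \<Rightarrow> 'a) \<Rightarrow> ('b \<Rightarrow> 'b \<Rightarrow> 'b \<Rightarrow> 'b) \<Rightarrow> ('a \<Rightarrow> 'b) \<Rightarrow> 'a \<Rightarrow> 'a \<times> 'a \<Rightarrow> 'a \<times> 'a" where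
  "R_map L mul \<mu> \<pi> l = (\<lambda>(u, v). (eta_map L mul \<mu> \<pi> l v u, xi_map L mul \<mu> \<pi> l u v))"

definition unitary_condition :: "'a set \<Rightarrow> ('a \<Rightarrow> 'a \<times> 'a \<Rightarrow> 'a \<times> 'a) \<Rightarrow> bool" where
  "unitary_condition L R \<longleftrightarrow>
     (\<forall>l\<in>L. \<forall>p \<in> L \<times> L. (R l \<circ> prod.swap \<circ> R l) p = prod.swap p)"

end

theory Submission
  imports Defs
begin

text \<open>
  Fix \<open>l\<close>. A pair \<open>(u, v)\<close> amounts to the path \<open>l\<close>, \<open>l u\<close>, \<open>(l u) v\<close> in \<open>L\<close>, because a path starting
  at \<open>l\<close> can be turned back into its steps by left division; transported along \<open>\<pi>\<close> it becomes a triple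
  \<open>(a, b, c)\<close> of points of \<open>M\<close> with \<open>a = \<pi> l\<close>. In these coordinates the pair \<open>(\<xi>, \<eta>)\<close> that
  \<open>R(l)\<close> produces, up to order, is the path with the same two ends whose middle point is
  \<open>\<mu> a b c\<close>: the definition of \<open>\<xi>\<close> prescribes the middle point, and that of \<open>\<eta>\<close> makes the path return to
  the old end point. So \<open>R(l)\<close> followed by the flip is the map of paths
  \<open>(a, b, c) \<mapsto> (a, \<mu> a b c, c)\<close>, and the unitary condition says that this map is an involution, that is,
  \<open>\<mu> a (\<mu> a b c) c = b\<close> for every triple coming from a path. As \<open>\<pi>\<close> and all left translations of \<open>L\<close> are
  surjective, every triple of points of \<open>M\<close> comes from a path.

  The correspondence is set up in \<open>pi_mul_xi\<close> and \<open>mul_mul_xi_eta\<close>, and \<open>R_swap_R_iff\<close> is the resulting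
  equivalence for a single path.
\<close>

lemma ldiv_props:
  assumes "left_quasigroup L mul" "u \<in> L" "w \<in> L"
  shows ldiv_closed: "ldiv L mul u w \<in> L"
    and mul_ldiv: "mul u (ldiv L mul u w) = w"
proof -
  have "\<exists>!v. v \<in> L \<and> mul u v = w"
    using assms by (simp add: left_quasigroup_def)
  from theI'[OF this] show "ldiv L mul u w \<in> L" "mul u (ldiv L mul u w) = w"
    by (simp_all add: ldiv_def)
qed

lemma mul_closed:
  "\<lbrakk>left_quasigroup L mul; u \<in> L; v \<in> L\<rbrakk> \<Longrightarrow> mul u v \<in> L"
  by (simp add: left_quasigroup_def)

lemma mul_left_cancel_iff:
  assumes "left_quasigroup L mul" "u \<in> L" "v \<in> L" "w \<in> L"
  shows "mul u v = mul u w \<longleftrightarrow> v = w"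
  using assms mul_closed[OF assms(1,2,3)] unfolding left_quasigroup_def by metis

context
  fixes L :: "'a set" and mul :: "'a \<Rightarrow> 'a \<Rightarrow> 'a"
    and M :: "'b set" and \<mu> :: "'b \<Rightarrow> 'b \<Rightarrow> 'b \<Rightarrow> 'b" and \<pi> :: "'a \<Rightarrow> 'b"
  assumes lq: "left_quasigroup L mul"
    and ts: "ternary_system M \<mu>"
    and bij: "bij_betw \<pi> L M"
begin

lemma pi_closed: "u \<in> L \<Longrightarrow> \<pi> u \<in> M"
  using bij by (rule bij_betwE[THEN bspec])

lemma mu_closed: "\<lbrakk>a \<in> M; b \<in> M; c \<in> M\<rbrakk> \<Longrightarrow> \<mu> a b c \<in> M"
  using ts by (simp add: ternary_system_def)

lemma inv_pi_mu_closed: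
  assumes "x \<in> L" "y \<in> L" "z \<in> L"
  shows "inv_into L \<pi> (\<mu> (\<pi> x) (\<pi> y) (\<pi> z)) \<in> L"
  using bij_betw_inv_into[OF bij, THEN bij_betwE] mu_closed[OF assms[THEN pi_closed]] by (rule bspec)

lemma xi_closed:
  assumes "l \<in> L" "u \<in> L" "v \<in> L"
  shows "xi_map L mul \<mu> \<pi> l u v \<in> L"
  using assms unfolding xi_map_def by (intro ldiv_closed[OF lq] inv_pi_mu_closed mul_closed[OF lq])

text \<open>
  The left division and the inverse of \<open>\<pi>\<close> in the definition of \<open>\<xi>\<close> cancel here, so that from now on
  \<open>\<xi>\<close> enters only through the middle point of the new path.
\<close>

lemma pi_mul_xi:
  assumes "l \<in> L" "u \<in> L" "v \<in> L"
  shows "\<pi> (mul l (xi_map L mul \<mu> \<pi> l u v)) = \<mu> (\<pi> l) (\<pi> (mul l u)) (\<pi> (mul (mul l u) v))"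
proof -
  let ?m = "\<mu> (\<pi> l) (\<pi> (mul l u)) (\<pi> (mul (mul l u) v))"
  have "?m \<in> M"
    using assms by (intro mu_closed pi_closed mul_closed[OF lq])
  then have "\<pi> (inv_into L \<pi> ?m) = ?m"
    by (rule bij_betw_inv_into_right[OF bij])
  moreover have "mul l (xi_map L mul \<mu> \<pi> l u v) = inv_into L \<pi> ?m"
    using assms unfolding xi_map_def by (intro mul_ldiv[OF lq] inv_pi_mu_closed mul_closed[OF lq])
  ultimately show ?thesis
    by simp
qed

text \<open>
  The companion fact for \<open>\<eta>\<close>: as a left quotient, it is the step from the new middle point to the
  unchanged end point of the path.
\<close>

lemma mul_mul_xi_eta:
  assumes "l \<in> L" "u \<in> L" "v \<in> L"
  shows "mul (mul l (xi_map L mul \<mu> \<pi> l u v)) (eta_map L mul \<mu> \<pi> l v u) = mul (mul l u) v"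
  using assms unfolding eta_map_def by (intro mul_ldiv[OF lq] mul_closed[OF lq] xi_closed)

lemma eta_closed:
  assumes "l \<in> L" "u \<in> L" "v \<in> L"
  shows "eta_map L mul \<mu> \<pi> l v u \<in> L"
  using assms unfolding eta_map_def by (intro ldiv_closed[OF lq] mul_closed[OF lq] xi_closed)

text \<open>
  Applying the change of path twice keeps both ends, so the original path is recovered exactly when
  its middle point is: the second step is determined by the middle and end points.
\<close>

lemma R_swap_R_iff:
  assumes l: "l \<in> L" and u: "u \<in> L" and v: "v \<in> L"
  defines "a \<equiv> \<pi> l" and "b \<equiv> \<pi> (mul l u)" and "c \<equiv> \<pi> (mul (mul l u) v)"
  shows "(R_map L mul \<mu> \<pi> l \<circ> prod.swap \<circ> R_map L mul \<mu> \<pi> l) (u, v) = prod.swap (u, v)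
         \<longleftrightarrow> \<mu> a (\<mu> a b c) c = b"
proof -
  define x where "x = xi_map L mul \<mu> \<pi> l u v"
  define y where "y = eta_map L mul \<mu> \<pi> l v u"
  define x' where "x' = xi_map L mul \<mu> \<pi> l x y"
  define y' where "y' = eta_map L mul \<mu> \<pi> l y x"
  have x: "x \<in> L" and y: "y \<in> L"
    using l u v by (simp_all add: x_def y_def xi_closed eta_closed)
  have x': "x' \<in> L" and y': "y' \<in> L"
    using l x y by (simp_all add: x'_def y'_def xi_closed eta_closed)
  have end_xy: "mul (mul l x) y = mul (mul l u) v"
    using l u v unfolding x_def y_def by (rule mul_mul_xi_eta)
  have end_xy': "mul (mul l x') y' = mul (mul l u) v"
    using mul_mul_xi_eta[OF l x y] end_xy by (simp add: x'_def y'_def)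
  have mid_x: "\<pi> (mul l x) = \<mu> a b c"
    using pi_mul_xi[OF l u v] by (simp add: x_def a_def b_def c_def)
  have mid_x': "\<pi> (mul l x') = \<mu> a (\<mu> a b c) c"
    using pi_mul_xi[OF l x y] by (simp add: x'_def mid_x end_xy a_def c_def)
  have "(R_map L mul \<mu> \<pi> l \<circ> prod.swap \<circ> R_map L mul \<mu> \<pi> l) (u, v) = (y', x')"
    by (simp add: R_map_def x_def y_def x'_def y'_def)
  then have "(R_map L mul \<mu> \<pi> l \<circ> prod.swap \<circ> R_map L mul \<mu> \<pi> l) (u, v) = prod.swap (u, v)
      \<longleftrightarrow> x' = u \<and> y' = v"
    by auto
  also have "\<dots> \<longleftrightarrow> x' = u"
    using end_xy' mul_left_cancel_iff[OF lq mul_closed[OF lq l u] y' v] by auto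
  also have "\<dots> \<longleftrightarrow> mul l x' = mul l u"
    using mul_left_cancel_iff[OF lq l x' u] by simp
  also have "\<dots> \<longleftrightarrow> \<pi> (mul l x') = b"
    unfolding b_def
    using inj_on_eq_iff[OF bij_betw_imp_inj_on[OF bij] mul_closed[OF lq l x'] mul_closed[OF lq l u]]
    by simp
  finally show ?thesis
    by (simp add: mid_x')
qed

lemma triple_is_path:
  assumes "a \<in> M" "b \<in> M" "c \<in> M"
  obtains l u v where "l \<in> L" "u \<in> L" "v \<in> L"
    "\<pi> l = a" "\<pi> (mul l u) = b" "\<pi> (mul (mul l u) v) = c"
proof -
  have "\<pi> ` L = M"
    using bij by (rule bij_betw_imp_surj_on)
  with assms obtain l p q where "l \<in> L" "p \<in> L" "q \<in> L" "\<pi> l = a" "\<pi> p = b" "\<pi> q = c"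
    by blast
  then show thesis
    using that[of l "ldiv L mul l p" "ldiv L mul p q"]
    by (simp add: ldiv_closed[OF lq] mul_ldiv[OF lq])
qed

end

theorem proposition7p1:
  fixes L :: "'a set" and mul :: "'a \<Rightarrow> 'a \<Rightarrow> 'a"
    and M :: "'b set" and \<mu> :: "'b \<Rightarrow> 'b \<Rightarrow> 'b \<Rightarrow> 'b"
    and \<pi> :: "'a \<Rightarrow> 'b"
  assumes "left_quasigroup L mul"
    and "ternary_system M \<mu>"
    and "\<forall>a\<in>M. \<forall>b\<in>M. \<forall>c\<in>M. \<forall>d\<in>M.
           \<mu> a (\<mu> a b c) (\<mu> (\<mu> a b c) c d) = \<mu> a b (\<mu> b c d)"
    and "\<forall>a\<in>M. \<forall>b\<in>M. \<forall>c\<in>M. \<forall>d\<in>M.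
           \<mu> (\<mu> a b c) c d = \<mu> (\<mu> a b (\<mu> b c d)) (\<mu> b c d) d"
    and "bij_betw \<pi> L M"
  shows "unitary_condition L (R_map L mul \<mu> \<pi>) \<longleftrightarrow>
         (\<forall>a\<in>M. \<forall>b\<in>M. \<forall>c\<in>M. \<mu> a (\<mu> a b c) c = b)"
proof -
  note R_iff = R_swap_R_iff[OF assms(1,2,5)]
  show ?thesis
  proof
    assume unitary: "unitary_condition L (R_map L mul \<mu> \<pi>)"
    show "\<forall>a\<in>M. \<forall>b\<in>M. \<forall>c\<in>M. \<mu> a (\<mu> a b c) c = b"
    proof (intro ballI)
      fix a b c
      assume "a \<in> M" "b \<in> M" "c \<in> M"
      then obtain l u v where luv: "l \<in> L" "u \<in> L" "v \<in> L"
        and path: "\<pi> l = a" "\<pi> (mul l u) = b" "\<pi> (mul (mul l u) v) = c"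
        by (rule triple_is_path[OF assms(1,2,5)])
      have "(R_map L mul \<mu> \<pi> l \<circ> prod.swap \<circ> R_map L mul \<mu> \<pi> l) (u, v) = prod.swap (u, v)"
        using unitary luv unfolding unitary_condition_def by blast
      then show "\<mu> a (\<mu> a b c) c = b"
        using R_iff[OF luv] path by simp
    qed
  next
    assume invol: "\<forall>a\<in>M. \<forall>b\<in>M. \<forall>c\<in>M. \<mu> a (\<mu> a b c) c = b"
    show "unitary_condition L (R_map L mul \<mu> \<pi>)"
      unfolding unitary_condition_def
    proof (intro ballI)
      fix l p
      assume l: "l \<in> L" and "p \<in> L \<times> L"
      then obtain u v where p: "p = (u, v)" and u: "u \<in> L" and v: "v \<in> L"
        by blast
      show "(R_map L mul \<mu> \<pi> l \<circ> prod.swap \<circ> R_map L mul \<mu> \<pi> l) p = prod.swap p"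
        unfolding p R_iff[OF l u v] using invol l u v
        by (simp add: pi_closed[OF assms(1,2,5)] mul_closed[OF assms(1)])
    qed
  qed
qed

end
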